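(* Let $X$ be a Banach space with topological dual $X^*$ and $K$ a nonempty convex subset of $X$. Assume that $T:X\rightrightarrows X^*$ is a set-valued map that is upper sign-continuous on $K$ and whose values are convex and compact sets. If $M(T,K)\neq\emptyset$, then there exists $\bar x\in K$ such that $$\sup_{x^*\in T(\bar x)}\langle x^*,y-\bar x\rangle\ge 0\qquad\text{for all } y\in K.$$
   Context: $X$ is a (real) Banach space, $X^*$ its topological dual, $\langle\cdot,\cdot\rangle$ the duality pairing. Conventions: $\inf\emptyset=+\infty$, $\sup\emptyset=-\infty$. $T$ is upper sign-continuous on a convex set $K$ if for all $x,y\in K$, with $x_t=tx+(1-t)y$: whenever $\inf_{x_t^*\in T(x_t)}\langle x_t^*,y-x\rangle\ge 0$ for all $t\in(0,1)$, one has $\sup_{x^*\in T(x)}\langle x^*,y-x\rangle\ge 0$. $M(T,K)=\{x\in K:\ \langle y^*,y-x\rangle\ge 0\ \ \forall y\in K,\ \forall y^*\in T(y)\}$ (Minty solutions). *)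

theory Defs
  imports "HOL-Analysis.Analysis"
begin

text \<open>The topological dual of \<open>'a\<close> is \<open>'a \<Rightarrow>\<^sub>L real\<close> with the operator norm.  Infima and
  suprema of the pairing are taken in \<^typ>\<open>ereal\<close>, so that the infimum over an empty set
  is \<open>\<infinity>\<close> and the supremum over an empty set is \<open>-\<infinity>\<close>.\<close>

definition upper_sign_continuous_on ::
    "'a::real_normed_vector set \<Rightarrow> ('a \<Rightarrow> ('a \<Rightarrow>\<^sub>L real) set) \<Rightarrow> bool" where
  "upper_sign_continuous_on K T \<longleftrightarrow>
    (\<forall>x\<in>K. \<forall>y\<in>K.
      (\<forall>t::real. 0 < t \<and> t < 1 \<longrightarrow>
        (INF u\<in>T (t *\<^sub>R x + (1 - t) *\<^sub>R y). ereal (blinfun_apply u (y - x))) \<ge> 0) \<longrightarrow>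
      (SUP u\<in>T x. ereal (blinfun_apply u (y - x))) \<ge> 0)"

definition minty_solutions ::
    "('a::real_normed_vector \<Rightarrow> ('a \<Rightarrow>\<^sub>L real) set) \<Rightarrow> 'a set \<Rightarrow> 'a set" where
  "minty_solutions T K = {x\<in>K. \<forall>y\<in>K. \<forall>v\<in>T y. blinfun_apply v (y - x) \<ge> 0}"

end

theory Submission
  imports Defs
begin

text \<open>Any Minty solution \<open>x\<close> already works. For \<open>y\<close> in
  \<open>K\<close>, each point \<open>z\<close> strictly between \<open>x\<close> and
  \<open>y\<close> lies in \<open>K\<close> by convexity, and \<open>z - x\<close> is a positive
  multiple of \<open>y - x\<close>. Hence the Minty inequality at \<open>z\<close> says that every
  element of \<open>T z\<close> is nonnegative in the direction \<open>y - x\<close>. This is the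
  premise of upper sign-continuity, which carries the sign to the supremum over
  \<open>T x\<close>.\<close>

theorem proposition3p9:
  fixes K :: "'a::banach set"
    and T :: "'a \<Rightarrow> ('a \<Rightarrow>\<^sub>L real) set"
  assumes "K \<noteq> {}"
    and "convex K"
    and "upper_sign_continuous_on K T"
    and "\<And>x. convex (T x)"
    and "\<And>x. compact (T x)"
    and "minty_solutions T K \<noteq> {}"
  shows "\<exists>x\<in>K. \<forall>y\<in>K. (SUP u\<in>T x. ereal (blinfun_apply u (y - x))) \<ge> 0"
proof -
  obtain x where xK: "x \<in> K" and minty: "\<And>y v. y \<in> K \<Longrightarrow> v \<in> T y \<Longrightarrow> 0 \<le> blinfun_apply v (y - x)"
    using assms(6) unfolding minty_solutions_def by blast
  have "(SUP u\<in>T x. ereal (blinfun_apply u (y - x))) \<ge> 0" if yK: "y \<in> K" for y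
  proof -
    have "(INF u\<in>T (t *\<^sub>R x + (1 - t) *\<^sub>R y). ereal (blinfun_apply u (y - x))) \<ge> 0"
      if t: "0 < t" "t < 1" for t :: real
    \<comment> \<open>A bound on each member suffices, also when the value of \<open>T\<close> is
      empty and the infimum is \<infinity>.\<close>
    proof (rule INF_greatest)
      let ?z = "t *\<^sub>R x + (1 - t) *\<^sub>R y"
      fix u assume u: "u \<in> T ?z"
      have "?z \<in> K"
        using convexD[OF assms(2) xK yK, of t "1 - t"] t by simp
      \<comment> \<open>The factor \<open>1 - t\<close> is positive since \<open>t < 1\<close>, so
        it can be cancelled from the Minty inequality at \<open>?z\<close>.\<close>
      moreover have "?z - x = (1 - t) *\<^sub>R (y - x)"
        by (simp add: algebra_simps)
      ultimately have "0 \<le> (1 - t) * blinfun_apply u (y - x)"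
        using minty[OF _ u] by (simp add: blinfun.scaleR_right)
      then show "0 \<le> ereal (blinfun_apply u (y - x))"
        using t by (simp add: zero_le_mult_iff)
    qed
    then show ?thesis
      using assms(3) xK yK unfolding upper_sign_continuous_on_def by blast
  qed
  then show ?thesis
    using xK by blast
qed

end
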